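(* For every integer $n\geq0$, \[ (q;q)_{2n}\,CP_{(4,0)}(n) = \sum_{r= -\infty}^\infty (-1)^r q^{r(3r+2)} {2 n\brack n-3r+(-1)^r-1}_q. \]
   Context: $(a;q)_m=\prod_{j=0}^{m-1}(1-aq^j)$; for integers $a,b$, ${a\brack b}_q=\frac{(q;q)_a}{(q;q)_b(q;q)_{a-b}}$ if $0\le b\le a$ and $0$ otherwise. A cylindric partition with profile $(c_1,c_2)$ is a pair of partitions $(\lambda^{(1)},\lambda^{(2)})$ (parts weakly decreasing, $\lambda^{(i)}_j=0$ beyond the number of parts) with $\lambda^{(1)}_j\ge\lambda^{(2)}_{j+c_2}$ and $\lambda^{(2)}_j\ge\lambda^{(1)}_{j+c_1}$ for all $j\ge1$; its size is $|\lambda^{(1)}|+|\lambda^{(2)}|$. $CP_{(4,0)}(n)$ is the generating function $\sum q^{\text{size}}$ over cylindric partitions of profile $(4,0)$ in which each partition has at most $n$ parts, with $CP_{(4,0)}(0)=1$. *)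

theory Defs
  imports
    "HOL-Computational_Algebra.Formal_Power_Series"
    "HOL-Library.Groups_Big_Fun"
begin

definition qpochhammer :: "'a::comm_ring_1 \<Rightarrow> 'a \<Rightarrow> nat \<Rightarrow> 'a" where
  "qpochhammer a q m = (\<Prod>j<m. 1 - a * q ^ j)"

(* The variable q is formal: it is the power series fps_X. The denominator has constant
   coefficient 1, so the quotient is the genuine one. *)
definition qbinomial :: "int \<Rightarrow> int \<Rightarrow> rat fps" where
  "qbinomial a b =
     (if 0 \<le> b \<and> b \<le> a
      then qpochhammer fps_X fps_X (nat a) /
             (qpochhammer fps_X fps_X (nat b) * qpochhammer fps_X fps_X (nat (a - b)))
      else 0)"

(* A partition is the weakly decreasing list of its positive parts, so that its number of
   parts is the length and its size is sum_list. *)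
definition is_partition :: "nat list \<Rightarrow> bool" where
  "is_partition xs \<longleftrightarrow> sorted_wrt (\<ge>) xs \<and> (\<forall>x\<in>set xs. 0 < x)"

(* Parts are indexed from 1; only indices j \<ge> 1 are ever used. *)
definition part :: "nat list \<Rightarrow> nat \<Rightarrow> nat" where
  "part xs j = (if 1 \<le> j \<and> j \<le> length xs then xs ! (j - 1) else 0)"

definition cylindric_partitions :: "nat \<Rightarrow> nat \<Rightarrow> (nat list \<times> nat list) set" where
  "cylindric_partitions c1 c2 =
     {(l1, l2). is_partition l1 \<and> is_partition l2 \<and>
        (\<forall>j\<ge>1. part l1 j \<ge> part l2 (j + c2) \<and> part l2 j \<ge> part l1 (j + c1))}"

definition bounded_cylindric_partitions ::
    "nat \<Rightarrow> nat \<Rightarrow> nat \<Rightarrow> nat \<Rightarrow> (nat list \<times> nat list) set" where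
  "bounded_cylindric_partitions c1 c2 n k =
     {(l1, l2) \<in> cylindric_partitions c1 c2.
        length l1 \<le> n \<and> length l2 \<le> n \<and> sum_list l1 + sum_list l2 = k}"

definition CP :: "nat \<Rightarrow> nat \<Rightarrow> nat \<Rightarrow> rat fps" where
  "CP c1 c2 n = Abs_fps (\<lambda>k. of_nat (card (bounded_cylindric_partitions c1 c2 n k)))"

lemma finite_bounded_cylindric_partitions:
  "finite (bounded_cylindric_partitions c1 c2 n k)"
proof (rule finite_subset)
  let ?L = "{xs. set xs \<subseteq> {..k} \<and> length xs \<le> n}"
  show "bounded_cylindric_partitions c1 c2 n k \<subseteq> ?L \<times> ?L"
    by (auto simp: bounded_cylindric_partitions_def dest!: member_le_sum_list)
  show "finite (?L \<times> ?L)"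
    by (intro finite_cartesian_product finite_lists_length_le) auto
qed

lemma CP_0: "CP c1 c2 0 = 1"
proof -
  have "bounded_cylindric_partitions c1 c2 0 k = (if k = 0 then {([], [])} else {})" for k
    by (auto simp: bounded_cylindric_partitions_def cylindric_partitions_def
          is_partition_def part_def)
  then show ?thesis
    by (auto simp: CP_def fps_eq_iff)
qed

(* Sum_any is the sum over the support, and 0 by convention when the support is infinite;
   this shows that the bilateral sum over r has finite support. *)
lemma finite_support_qbinomial:
  "finite {r :: int. c r * qbinomial (2 * int n) (int n - 3 * r + (-1) ^ nat \<bar>r\<bar> - 1) \<noteq> 0}"
proof (rule finite_subset)
  show "{r :: int. c r * qbinomial (2 * int n) (int n - 3 * r + (-1) ^ nat \<bar>r\<bar> - 1) \<noteq> 0}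
        \<subseteq> {- int n - 2..int n + 2}"
  proof
    fix r :: int
    assume "r \<in> {r. c r * qbinomial (2 * int n) (int n - 3 * r + (-1) ^ nat \<bar>r\<bar> - 1) \<noteq> 0}"
    then have *: "0 \<le> int n - 3 * r + (-1) ^ nat \<bar>r\<bar> - 1"
        "int n - 3 * r + (-1) ^ nat \<bar>r\<bar> - 1 \<le> 2 * int n"
      by (auto simp: qbinomial_def split: if_splits)
    have "(-1 :: int) ^ nat \<bar>r\<bar> = 1 \<or> (-1 :: int) ^ nat \<bar>r\<bar> = -1"
      by (cases "even (nat \<bar>r\<bar>)") auto
    with * show "r \<in> {- int n - 2..int n + 2}" by auto
  qed
qed simp

end

theory Submission
  imports Defs
begin

text \<open>
  Let F(a,b) be the generating function of the cylindric partitions of profile (4,0) whose two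
  partitions have at most a and b parts. The two lengths of a cylindric partition always lie in
  the strip 0 \<le> a - b \<le> 4, so that F(b-1,b) = F(b-1,b-1) and F(b+5,b) = F(b+4,b). Subtracting 1
  from every part maps the pairs with exactly a and b parts onto those with at most a and b
  parts; hence by inclusion-exclusion, for (a,b) in the strip,
  (1 - q^(a+b)) F(a,b) = F(a-1,b) + F(a,b-1) - F(a-1,b-1).

  Every shifted q-binomial coefficient [a+b; b+s] satisfies the recurrence that this implies for
  (q;q)_(a+b) F(a,b). A combination of them with weights c(s) satisfies the two boundary conditions
  if c(-1-s) = -q^(2s+1) c(s) and c(5-s) = -q^(5-2s) c(s). These two reflections generate, from
  c(0) = 1, the weights on s = -6m and s = 6m-1 that form the alternating sum.
\<close>

section \<open>q-Pochhammer symbols and q-binomial coefficients\<close>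

lemma qpochhammer_Suc:
  "qpochhammer fps_X fps_X (Suc n) = qpochhammer fps_X fps_X n * (1 - fps_X ^ Suc n :: rat fps)"
  by (simp add: qpochhammer_def)

lemma fps_nth_0_qpochhammer: "fps_nth (qpochhammer fps_X fps_X n :: rat fps) 0 = 1"
  by (induction n) (simp_all add: qpochhammer_Suc, simp add: qpochhammer_def)

lemma qpochhammer_nonzero: "qpochhammer fps_X fps_X n \<noteq> (0 :: rat fps)"
  using fps_nth_0_qpochhammer[of n] by auto

lemma one_minus_fps_X_power_nonzero: "0 < n \<Longrightarrow> 1 - fps_X ^ n \<noteq> (0 :: rat fps)"
proof
  assume "0 < n" "1 - fps_X ^ n = (0 :: rat fps)"
  then have "fps_nth (1 - fps_X ^ n :: rat fps) 0 = 0" by simp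
  with \<open>0 < n\<close> show False by simp
qed

text \<open>The denominator has constant coefficient 1, so it is a unit and the division is exact.
  Later identities use this cross-multiplied form.\<close>

lemma qbinomial_mult:
  assumes "0 \<le> b" "b \<le> a"
  shows "qbinomial a b * (qpochhammer fps_X fps_X (nat b) * qpochhammer fps_X fps_X (nat (a - b)))
    = qpochhammer fps_X fps_X (nat a)"
proof -
  let ?d = "qpochhammer fps_X fps_X (nat b) * qpochhammer fps_X fps_X (nat (a - b)) :: rat fps"
  have "fps_nth ?d 0 \<noteq> 0" by (simp add: fps_nth_0_qpochhammer)
  then have "inverse ?d * ?d = 1" by (rule inverse_mult_eq_1)
  with \<open>fps_nth ?d 0 \<noteq> 0\<close> show ?thesis
    using assms by (simp add: qbinomial_def fps_divide_unit mult.assoc del: fps_mult_nth_0)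
qed

lemma qbinomial_eq_0: "b < 0 \<or> a < b \<Longrightarrow> qbinomial a b = 0"
  by (auto simp: qbinomial_def)

lemma qbinomial_symmetric: "qbinomial a (a - b) = qbinomial a b"
  by (auto simp: qbinomial_def mult.commute)

lemma qbinomial_0_0: "qbinomial 0 0 = 1"
  by (simp add: qbinomial_def qpochhammer_def)

lemma qpochhammer_nat:
  assumes "1 \<le> a"
  shows "qpochhammer fps_X fps_X (nat a)
    = qpochhammer fps_X fps_X (nat (a - 1)) * (1 - fps_X ^ nat a :: rat fps)"
proof -
  have "nat a = Suc (nat (a - 1))" using assms by simp
  then show ?thesis by (metis qpochhammer_Suc)
qed

text \<open>In the range 1 \<le> b \<le> a, multiplying either side by (q;q)_(b-1) (q;q)_(a-b) gives
  (q;q)_a.\<close>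

lemma qbinomial_absorb_lower:
  assumes "1 \<le> a"
  shows "(1 - fps_X ^ nat a) * qbinomial (a - 1) (b - 1) = (1 - fps_X ^ nat b) * qbinomial a b"
proof (cases "1 \<le> b \<and> b \<le> a")
  case True
  let ?p = "\<lambda>k. qpochhammer fps_X fps_X (nat k) :: rat fps"
  have 1: "qbinomial (a - 1) (b - 1) * (?p (b - 1) * ?p (a - b)) = ?p (a - 1)"
    using qbinomial_mult[of "b - 1" "a - 1"] True by simp
  have 2: "qbinomial a b * (?p b * ?p (a - b)) = ?p a"
    using qbinomial_mult[of b a] True by simp
  have "(?p (b - 1) * ?p (a - b)) * ((1 - fps_X ^ nat a) * qbinomial (a - 1) (b - 1)) = ?p a"
    using 1 qpochhammer_nat[OF assms] by (simp add: mult_ac)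
  also have "\<dots> = (?p (b - 1) * ?p (a - b)) * ((1 - fps_X ^ nat b) * qbinomial a b)"
    using 2 qpochhammer_nat[of b] True by (simp add: mult_ac)
  finally show ?thesis by (simp add: qpochhammer_nonzero)
next
  case False
  \<comment> \<open>For b = 0 the right side vanishes through 1 - q^0; in the other two cases both
    coefficients are 0.\<close>
  then consider "b < 0" | "b = 0" | "a < b" by linarith
  then show ?thesis using assms by cases (simp_all add: qbinomial_eq_0)
qed

lemma qbinomial_absorb_upper:
  assumes "1 \<le> a"
  shows "(1 - fps_X ^ nat a) * qbinomial (a - 1) b = (1 - fps_X ^ nat (a - b)) * qbinomial a b"
  using qbinomial_absorb_lower[OF assms, of "a - b"] qbinomial_symmetric[of a b]
    qbinomial_symmetric[of "a - 1" b] by (simp add: algebra_simps)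

text \<open>After multiplication by 1 - q^a, the two absorption identities reduce this to (1 - q^b)
  + q^b (1 - q^(a-b)) = 1 - q^a.\<close>

lemma qbinomial_pascal:
  assumes "1 \<le> a"
  shows "qbinomial a b = qbinomial (a - 1) (b - 1) + fps_X ^ nat b * qbinomial (a - 1) b"
proof (cases "0 \<le> b \<and> b \<le> a")
  case True
  then have e: "fps_X ^ nat a = (fps_X ^ nat b * fps_X ^ nat (a - b) :: rat fps)"
    by (simp flip: power_add nat_add_distrib)
  have "(1 - fps_X ^ nat a) * (qbinomial (a - 1) (b - 1) + fps_X ^ nat b * qbinomial (a - 1) b)
      = (1 - fps_X ^ nat a) * qbinomial (a - 1) (b - 1)
        + fps_X ^ nat b * ((1 - fps_X ^ nat a) * qbinomial (a - 1) b)"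
    by (simp add: algebra_simps)
  also have "\<dots> = (1 - fps_X ^ nat a) * qbinomial a b"
    unfolding qbinomial_absorb_lower[OF assms, of b] qbinomial_absorb_upper[OF assms, of b]
    by (simp add: e algebra_simps)
  finally show ?thesis
    using one_minus_fps_X_power_nonzero[of "nat a"] assms by simp
next
  case False
  then show ?thesis by (auto simp: qbinomial_eq_0)
qed

text \<open>In Pascal's rule, q^b is written as 1 - (1 - q^b), and absorption turns 1 - q^b into a
  factor free of b. Since no factor depends on b any more, the recurrence passes to every weighted
  sum of shifted coefficients.\<close>

lemma qbinomial_rec:
  assumes "1 \<le> a"
  shows "qbinomial a b = qbinomial (a - 1) b + qbinomial (a - 1) (b - 1)
    - (1 - fps_X ^ nat (a - 1)) * qbinomial (a - 2) (b - 1)"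
\<comment> \<open>Absorption is applied at a - 1, which must be at least 1; for a = 1 the last term
  vanishes through its factor 1 - q^0.\<close>
proof (cases "a = 1")
  case True
  then show ?thesis using qbinomial_pascal[OF assms, of b]
    by (cases "b = 0") (auto simp: qbinomial_def)
next
  case False
  then have "(1 - fps_X ^ nat (a - 1)) * qbinomial (a - 2) (b - 1)
      = (1 - fps_X ^ nat b) * qbinomial (a - 1) b"
    using qbinomial_absorb_lower[of "a - 1" b] assms by simp
  then show ?thesis using qbinomial_pascal[OF assms, of b] by (simp add: algebra_simps)
qed

section \<open>The alternating sum as a function of two bounds\<close>

text \<open>
  The terms r = 2m and r = 2m-1 of the bilateral sum, the latter with its q-binomial coefficient
  reflected: this is immaterial for a = b, but the boundary conditions fail without it.
\<close>

definition even_term :: "int \<Rightarrow> int \<Rightarrow> int \<Rightarrow> rat fps" where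
  "even_term a b m = fps_X ^ nat (4 * m * (3 * m + 1)) * qbinomial (a + b) (b - 6 * m)"

definition odd_term :: "int \<Rightarrow> int \<Rightarrow> int \<Rightarrow> rat fps" where
  "odd_term a b m = fps_X ^ nat ((2 * m - 1) * (6 * m - 1)) * qbinomial (a + b) (b + 6 * m - 1)"

text \<open>The candidate for (q;q)_(a+b) F(a,b).\<close>

definition altsum :: "int \<Rightarrow> int \<Rightarrow> rat fps" where
  "altsum a b = Sum_any (even_term a b) - Sum_any (odd_term a b)"

lemma finite_qbinomial_support:
  assumes "u \<noteq> 0"
  shows "finite {m :: int. c m * qbinomial a (b + u * m) \<noteq> 0}"
proof (rule finite_subset)
  show "{m. c m * qbinomial a (b + u * m) \<noteq> 0} \<subseteq> (\<lambda>m. b + u * m) -` {0..a}"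
    by (auto simp: qbinomial_def split: if_splits)
  show "finite ((\<lambda>m. b + u * m) -` {0..a})"
    using assms by (intro finite_vimageI) (auto simp: inj_def)
qed

lemma finite_even_term: "finite {m. even_term a b m \<noteq> 0}"
  using finite_qbinomial_support[of "-6" "\<lambda>m. fps_X ^ nat (4 * m * (3 * m + 1))" "a + b" b]
  by (simp add: even_term_def)

lemma finite_odd_term: "finite {m. odd_term a b m \<noteq> 0}"
  using finite_qbinomial_support[of 6 "\<lambda>m. fps_X ^ nat ((2 * m - 1) * (6 * m - 1))" "a + b" "b - 1"]
  by (simp add: odd_term_def algebra_simps)

text \<open>\<open>Sum_any\<close> is 0 on an infinite support, so linearity is obtained by summing
  over the finite union of the supports.\<close>

lemma Sum_any_lincomb:
  fixes f g h :: "'b \<Rightarrow> 'a :: comm_ring_1"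
  assumes "finite {m. f m \<noteq> 0}" "finite {m. g m \<noteq> 0}" "finite {m. h m \<noteq> 0}"
  shows "Sum_any (\<lambda>m. f m + g m - c * h m) = Sum_any f + Sum_any g - c * Sum_any h"
proof -
  let ?S = "{m. f m \<noteq> 0} \<union> {m. g m \<noteq> 0} \<union> {m. h m \<noteq> 0}"
  have S: "finite ?S" using assms by simp
  have "Sum_any (\<lambda>m. f m + g m - c * h m) = (\<Sum>m\<in>?S. f m + g m - c * h m)"
    by (rule Sum_any.expand_superset[OF S]) auto
  also have "\<dots> = sum f ?S + sum g ?S - c * sum h ?S"
    by (simp only: sum_subtractf sum.distrib sum_distrib_left)
  also have "sum f ?S = Sum_any f" by (rule Sum_any.expand_superset[OF S, symmetric]) auto
  also have "sum g ?S = Sum_any g" by (rule Sum_any.expand_superset[OF S, symmetric]) auto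
  also have "sum h ?S = Sum_any h" by (rule Sum_any.expand_superset[OF S, symmetric]) auto
  finally show ?thesis .
qed

lemma Sum_any_shift:
  fixes f :: "int \<Rightarrow> 'a :: comm_monoid_add"
  shows "Sum_any (\<lambda>m. f (m + 1)) = Sum_any f"
  by (rule Sum_any.reindex_cong[of "\<lambda>m. m + 1", symmetric])
     (auto simp: fun_eq_iff bij_def inj_def surj_def intro: exI[of _ "_ - 1"])

lemma Sum_any_parity_split:
  fixes f :: "int \<Rightarrow> 'a :: comm_monoid_add"
  assumes "finite {r. f r \<noteq> 0}"
  shows "Sum_any f = Sum_any (\<lambda>m. f (2 * m)) + Sum_any (\<lambda>m. f (2 * m - 1))"
proof -
  let ?E = "{m. f (2 * m) \<noteq> 0}" and ?O = "{m. f (2 * m - 1) \<noteq> 0}"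
  have inj: "inj_on (\<lambda>m :: int. 2 * m) A" "inj_on (\<lambda>m :: int. 2 * m - 1) A" for A
    by (auto simp: inj_on_def)
  have S: "{r. f r \<noteq> 0} = (\<lambda>m. 2 * m) ` ?E \<union> (\<lambda>m. 2 * m - 1) ` ?O" (is "_ = ?A \<union> ?B")
  proof (intro equalityI subsetI)
    fix r assume r: "r \<in> {r. f r \<noteq> 0}"
    show "r \<in> ?A \<union> ?B"
    proof (cases "even r")
      case True
      then show ?thesis using r by (auto elim!: evenE)
    next
      case False
      \<comment> \<open>The odd index 2k + 1 has m = k + 1, because odd integers are parametrised as
        2m - 1 to match \<open>odd_term\<close>.\<close>
      then obtain k where "r = 2 * (k + 1) - 1" by (auto elim!: oddE)
      then show ?thesis using r by blast
    qed
  qed auto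
  have "even r" if "r \<in> ?A" for r using that by auto
  moreover have "odd r" if "r \<in> ?B" for r using that by auto
  ultimately have "?A \<inter> ?B = {}" by blast
  moreover have "finite ?A" "finite ?B"
    using assms unfolding S by auto
  ultimately have "sum f {r. f r \<noteq> 0} = sum f ?A + sum f ?B"
    unfolding S by (intro sum.union_disjoint)
  then show ?thesis
    by (simp add: Sum_any.expand_set sum.reindex[OF inj(1)] sum.reindex[OF inj(2)] o_def)
qed

section \<open>Recurrence and boundary conditions of the alternating sum\<close>

text \<open>The weights depend on m alone, so \<open>qbinomial_rec\<close> applies term by term:
  lowering a keeps the lower index, lowering b decreases it by 1.\<close>

lemma altsum_rec:
  assumes "1 \<le> a + b"
  shows "altsum a b = altsum (a - 1) b + altsum a (b - 1)
    - (1 - fps_X ^ nat (a + b - 1)) * altsum (a - 1) (b - 1)"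
proof -
  let ?c = "1 - fps_X ^ nat (a + b - 1) :: rat fps"
  have "even_term a b m = even_term (a - 1) b m + even_term a (b - 1) m
      - ?c * even_term (a - 1) (b - 1) m" for m
  proof -
    have "even_term a b m = fps_X ^ nat (4 * m * (3 * m + 1)) *
        (qbinomial (a + b - 1) (b - 6 * m) + qbinomial (a + b - 1) (b - 6 * m - 1)
          - ?c * qbinomial (a + b - 2) (b - 6 * m - 1))"
      by (simp only: even_term_def qbinomial_rec[OF assms])
    then show ?thesis by (simp add: even_term_def algebra_simps)
  qed
  then have e: "even_term a b = (\<lambda>m. even_term (a - 1) b m + even_term a (b - 1) m
      - ?c * even_term (a - 1) (b - 1) m)" by blast
  have "odd_term a b m = odd_term (a - 1) b m + odd_term a (b - 1) m
      - ?c * odd_term (a - 1) (b - 1) m" for m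
  proof -
    have "odd_term a b m = fps_X ^ nat ((2 * m - 1) * (6 * m - 1)) *
        (qbinomial (a + b - 1) (b + 6 * m - 1) + qbinomial (a + b - 1) (b + 6 * m - 1 - 1)
          - ?c * qbinomial (a + b - 2) (b + 6 * m - 1 - 1))"
      by (simp only: odd_term_def qbinomial_rec[OF assms])
    then show ?thesis by (simp add: odd_term_def algebra_simps)
  qed
  then have o: "odd_term a b = (\<lambda>m. odd_term (a - 1) b m + odd_term a (b - 1) m
      - ?c * odd_term (a - 1) (b - 1) m)" by blast
  show ?thesis
    unfolding altsum_def e o
    by (subst (1 2) Sum_any_lincomb)
       (simp_all add: finite_even_term finite_odd_term algebra_simps)
qed

lemma Sum_any_diff_mult:
  fixes f h :: "'b \<Rightarrow> 'a :: comm_ring_1"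
  assumes "finite {m. f m \<noteq> 0}" "finite {m. h m \<noteq> 0}"
  shows "Sum_any (\<lambda>m. f m - c * h m) = Sum_any f - c * Sum_any h"
  using Sum_any_lincomb[of f "\<lambda>_. 0" h c] assms by simp

text \<open>Exponents such as b - 6m can be negative and are then truncated by \<open>nat\<close>.
  They have to add up only where the q-binomial coefficient can be nonzero.\<close>

lemma fps_X_power_qbinomial:
  assumes "0 \<le> i" "0 \<le> k \<Longrightarrow> k \<le> a \<Longrightarrow> i + j = l \<and> 0 \<le> j"
  shows "fps_X ^ nat i * (fps_X ^ nat j * qbinomial a k) = fps_X ^ nat l * qbinomial a k"
proof (cases "0 \<le> k \<and> k \<le> a")
  case True
  then show ?thesis using assms
    by (metis mult.assoc nat_add_distrib power_add)
next
  case False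
  then show ?thesis by (auto simp: qbinomial_eq_0)
qed

lemma even_exponent_nonneg: "0 \<le> 4 * m * (3 * m + 1)" for m :: int
  by (cases "0 \<le> m") (auto simp: zero_le_mult_iff)

lemma odd_exponent_nonneg: "0 \<le> (2 * m - 1) * (6 * m - 1)" for m :: int
  by (cases "1 \<le> m") (auto simp: zero_le_mult_iff)

text \<open>By absorption the term with lower index k contributes q^k times its weight and
  coefficient to the difference of the two sides. The reflection s \<mapsto> -1 - s exchanges s =
  -6m and s = 6m - 1, so the even and odd contributions of the same m cancel.\<close>

lemma altsum_lower_boundary:
  assumes "1 \<le> b"
  shows "altsum (b - 1) b = (1 - fps_X ^ nat (2 * b - 1)) * altsum (b - 1) (b - 1)"
proof -
  let ?c = "1 - fps_X ^ nat (2 * b - 1) :: rat fps"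
  \<comment> \<open>The common contribution: 4m(3m+1) + (b-6m) and (2m-1)(6m-1) + (b+6m-1) both
    equal 12m^2 - 2m + b.\<close>
  let ?X = "\<lambda>m. fps_X ^ nat (12 * m * m - 2 * m + b) * qbinomial (2 * b - 1) (b - 6 * m)"
  have absorb: "?c * qbinomial (b - 1 + (b - 1)) (k - 1)
      = (1 - fps_X ^ nat k) * qbinomial (2 * b - 1) k" for k
    using qbinomial_absorb_lower[of "2 * b - 1" k] assms by (simp add: algebra_simps)
  have "even_term (b - 1) b m - ?c * even_term (b - 1) (b - 1) m = ?X m" for m
  proof -
    let ?e = "fps_X ^ nat (4 * m * (3 * m + 1)) :: rat fps"
    have "even_term (b - 1) b m - ?c * even_term (b - 1) (b - 1) m
        = ?e * qbinomial (2 * b - 1) (b - 6 * m)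
          - ?e * (?c * qbinomial (b - 1 + (b - 1)) (b - 6 * m - 1))"
      by (simp add: even_term_def algebra_simps)
    also have "\<dots> = ?e * (fps_X ^ nat (b - 6 * m) * qbinomial (2 * b - 1) (b - 6 * m))"
      unfolding absorb by (simp add: algebra_simps)
    also have "\<dots> = ?X m"
      by (rule fps_X_power_qbinomial[OF even_exponent_nonneg]) (simp add: algebra_simps)
    finally show ?thesis .
  qed
  moreover have "odd_term (b - 1) b m - ?c * odd_term (b - 1) (b - 1) m = ?X m" for m
  proof -
    let ?e = "fps_X ^ nat ((2 * m - 1) * (6 * m - 1)) :: rat fps"
    have "odd_term (b - 1) b m - ?c * odd_term (b - 1) (b - 1) m
        = ?e * qbinomial (2 * b - 1) (b + 6 * m - 1)
          - ?e * (?c * qbinomial (b - 1 + (b - 1)) (b + 6 * m - 1 - 1))"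
      by (simp add: odd_term_def algebra_simps)
    also have "\<dots> = ?e * (fps_X ^ nat (b + 6 * m - 1) * qbinomial (2 * b - 1) (b + 6 * m - 1))"
      unfolding absorb by (simp add: algebra_simps)
    also have "\<dots> = fps_X ^ nat (12 * m * m - 2 * m + b) * qbinomial (2 * b - 1) (b + 6 * m - 1)"
      by (rule fps_X_power_qbinomial[OF odd_exponent_nonneg]) (simp add: algebra_simps)
    also have "\<dots> = ?X m"
      using qbinomial_symmetric[of "2 * b - 1" "b - 6 * m"] by (simp add: algebra_simps)
    finally show ?thesis .
  qed
  ultimately have "Sum_any (\<lambda>m. even_term (b - 1) b m - ?c * even_term (b - 1) (b - 1) m)
      = Sum_any (\<lambda>m. odd_term (b - 1) b m - ?c * odd_term (b - 1) (b - 1) m)"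
    by (simp only:)
  then show ?thesis
    by (simp only: Sum_any_diff_mult finite_even_term finite_odd_term)
       (simp add: altsum_def algebra_simps)
qed

text \<open>Here the lower index stays fixed, so absorption in the other form leaves q^(2b+5-k). The
  reflection s \<mapsto> 5 - s sends -6m to 6(m+1) - 1: the even term of m cancels the odd term of m
  + 1, whence the index shift at the end.\<close>

lemma altsum_upper_boundary:
  assumes "0 \<le> b"
  shows "altsum (b + 5) b = (1 - fps_X ^ nat (2 * b + 5)) * altsum (b + 4) b"
proof -
  let ?c = "1 - fps_X ^ nat (2 * b + 5) :: rat fps"
  let ?X = "\<lambda>m. fps_X ^ nat (12 * m * m + 10 * m + b + 5) * qbinomial (2 * b + 5) (b - 6 * m)"
  have absorb: "?c * qbinomial (b + 4 + b) k
      = (1 - fps_X ^ nat (2 * b + 5 - k)) * qbinomial (2 * b + 5) k" for k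
    using qbinomial_absorb_upper[of "2 * b + 5" k] assms by (simp add: algebra_simps)
  have "even_term (b + 5) b m - ?c * even_term (b + 4) b m = ?X m" for m
  proof -
    let ?e = "fps_X ^ nat (4 * m * (3 * m + 1)) :: rat fps"
    have "even_term (b + 5) b m - ?c * even_term (b + 4) b m
        = ?e * qbinomial (2 * b + 5) (b - 6 * m)
          - ?e * (?c * qbinomial (b + 4 + b) (b - 6 * m))"
      by (simp add: even_term_def algebra_simps)
    also have "\<dots> = ?e * (fps_X ^ nat (2 * b + 5 - (b - 6 * m)) * qbinomial (2 * b + 5) (b - 6 * m))"
      unfolding absorb by (simp add: algebra_simps)
    also have "\<dots> = ?X m"
      by (rule fps_X_power_qbinomial[OF even_exponent_nonneg]) (simp add: algebra_simps)
    finally show ?thesis .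
  qed
  moreover have "odd_term (b + 5) b (m + 1) - ?c * odd_term (b + 4) b (m + 1) = ?X m" for m
  proof -
    let ?e = "fps_X ^ nat ((2 * (m + 1) - 1) * (6 * (m + 1) - 1)) :: rat fps"
    let ?k = "b + 6 * (m + 1) - 1"
    have "odd_term (b + 5) b (m + 1) - ?c * odd_term (b + 4) b (m + 1)
        = ?e * qbinomial (2 * b + 5) ?k - ?e * (?c * qbinomial (b + 4 + b) ?k)"
      by (simp add: odd_term_def algebra_simps)
    also have "\<dots> = ?e * (fps_X ^ nat (2 * b + 5 - ?k) * qbinomial (2 * b + 5) ?k)"
      unfolding absorb by (simp add: algebra_simps)
    also have "\<dots> = fps_X ^ nat (12 * m * m + 10 * m + b + 5) * qbinomial (2 * b + 5) ?k"
      by (rule fps_X_power_qbinomial[OF odd_exponent_nonneg]) (simp add: algebra_simps)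
    also have "\<dots> = ?X m"
      using qbinomial_symmetric[of "2 * b + 5" "b - 6 * m"] by (simp add: algebra_simps)
    finally show ?thesis .
  qed
  ultimately have "Sum_any (\<lambda>m. even_term (b + 5) b m - ?c * even_term (b + 4) b m)
      = Sum_any (\<lambda>m. odd_term (b + 5) b (m + 1) - ?c * odd_term (b + 4) b (m + 1))"
    by (simp only:)
  also have "\<dots> = Sum_any (\<lambda>m. odd_term (b + 5) b m - ?c * odd_term (b + 4) b m)"
    by (rule Sum_any_shift)
  finally show ?thesis
    by (simp only: Sum_any_diff_mult finite_even_term finite_odd_term)
       (simp add: altsum_def algebra_simps)
qed

text \<open>The lower indices are congruent to 5 or 4 modulo 6, while the upper index a - 1 is at
  most 3. This row of zeros makes the recurrence usable at b = 0.\<close>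

lemma altsum_minus_1:
  assumes "a \<le> 4"
  shows "altsum a (- 1) = 0"
proof -
  have "even_term a (- 1) m = 0" for m
  proof -
    have "- 1 - 6 * m < 0 \<or> a + - 1 < - 1 - 6 * m" using assms by presburger
    then show ?thesis by (simp add: even_term_def qbinomial_eq_0)
  qed
  moreover have "odd_term a (- 1) m = 0" for m
  proof -
    have "- 1 + 6 * m - 1 < 0 \<or> a + - 1 < - 1 + 6 * m - 1" using assms by presburger
    then show ?thesis by (simp add: odd_term_def qbinomial_eq_0)
  qed
  ultimately show ?thesis by (simp add: altsum_def)
qed

lemma altsum_0_0: "altsum 0 0 = 1"
proof -
  have e: "even_term 0 0 m = (if m = 0 then 1 else 0)" for m
  proof -
    have "m = 0 \<or> 0 - 6 * m < 0 \<or> 0 + 0 < 0 - 6 * m" by presburger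
    then show ?thesis by (auto simp: even_term_def qbinomial_0_0 qbinomial_eq_0)
  qed
  have o: "odd_term 0 0 m = 0" for m
  proof -
    have "0 + 6 * m - 1 < 0 \<or> 0 + 0 < 0 + 6 * m - 1" by presburger
    then show ?thesis by (simp add: odd_term_def qbinomial_eq_0)
  qed
  show ?thesis by (simp add: altsum_def e o)
qed

lemma Sum_any_eq_altsum:
  "Sum_any (\<lambda>r :: int. (-1) ^ nat \<bar>r\<bar> * fps_X ^ nat (r * (3 * r + 2)) *
      qbinomial (2 * int n) (int n - 3 * r + (-1) ^ nat \<bar>r\<bar> - 1)) = altsum (int n) (int n)"
  (is "Sum_any ?f = _")
proof -
  have "?f (2 * m) = even_term (int n) (int n) m" for m
  proof -
    have "even (nat \<bar>2 * m\<bar>)" by (simp add: even_nat_iff)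
    then show ?thesis by (simp add: even_term_def algebra_simps)
  qed
  moreover have "?f (2 * m - 1) = - odd_term (int n) (int n) m" for m
  proof -
    have "odd (nat \<bar>2 * m - 1\<bar>)" by (simp add: even_nat_iff)
    \<comment> \<open>The summand has lower index n - 6m + 1, which is 2n - (n + 6m - 1).\<close>
    then show ?thesis using qbinomial_symmetric[of "2 * int n" "int n + 6 * m - 1"]
      by (simp add: odd_term_def algebra_simps)
  qed
  moreover have "Sum_any (\<lambda>m. - odd_term (int n) (int n) m) = - Sum_any (odd_term (int n) (int n))"
    by (simp add: Sum_any.expand_set sum_negf)
  ultimately show ?thesis
    unfolding Sum_any_parity_split[of ?f, OF finite_support_qbinomial] by (simp only: altsum_def) simp
qed

section \<open>Removing and adding the first column of a Young diagram\<close>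

definition remove_column :: "nat list \<Rightarrow> nat list" where
  "remove_column xs = filter (\<lambda>x. 0 < x) (map (\<lambda>x. x - 1) xs)"

definition add_column :: "nat \<Rightarrow> nat list \<Rightarrow> nat list" where
  "add_column a xs = map Suc xs @ replicate (a - length xs) 1"

lemma is_partition_Cons:
  "is_partition (x # xs) \<longleftrightarrow> 0 < x \<and> (\<forall>y\<in>set xs. y \<le> x) \<and> is_partition xs"
  by (auto simp: is_partition_def)

lemma part_Cons: "part (x # xs) j = (if j = 1 then x else if j = 0 then 0 else part xs (j - 1))"
  by (cases j; cases "j - 1") (auto simp: part_def)

lemma part_in_set: "part xs j = 0 \<or> part xs j \<in> set xs"
  by (auto simp: part_def)

lemma part_pos_iff: "is_partition xs \<Longrightarrow> 0 < part xs j \<longleftrightarrow> 1 \<le> j \<and> j \<le> length xs"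
  by (auto simp: is_partition_def part_def)

lemma remove_column_Cons:
  "remove_column (x # xs) = (if 1 < x then (x - 1) # remove_column xs else remove_column xs)"
  by (auto simp: remove_column_def)

lemma remove_column_eq_Nil: "\<forall>x\<in>set xs. x \<le> 1 \<Longrightarrow> remove_column xs = []"
  by (auto simp: remove_column_def filter_empty_conv)

lemma set_remove_column: "set (remove_column xs) \<subseteq> (\<lambda>x. x - 1) ` set xs"
  by (auto simp: remove_column_def)

lemma is_partition_remove_column: "is_partition xs \<Longrightarrow> is_partition (remove_column xs)"
proof (induction xs)
  case (Cons x xs)
  then show ?case using set_remove_column[of xs]
    by (fastforce simp: is_partition_Cons remove_column_Cons)
qed (simp add: is_partition_def remove_column_def)

lemma length_remove_column: "length (remove_column xs) \<le> length xs"
  by (metis length_filter_le length_map remove_column_def)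

lemma part_remove_column: "is_partition xs \<Longrightarrow> part (remove_column xs) j = part xs j - 1"
proof (induction xs arbitrary: j)
  case (Cons x xs)
  show ?case
  proof (cases "1 < x")
    case True
    then show ?thesis using Cons by (simp add: is_partition_Cons remove_column_Cons part_Cons)
  next
    case False
    \<comment> \<open>A head of at most 1 bounds every part by 1, so nothing survives the
      removal.\<close>
    then have le: "\<forall>y\<in>set (x # xs). y \<le> 1" using Cons.prems by (fastforce simp: is_partition_Cons)
    then have "part (x # xs) j \<le> 1" using part_in_set[of "x # xs" j] by auto
    then show ?thesis using remove_column_eq_Nil[OF le] by (simp add: part_def)
  qed
qed (simp add: remove_column_def part_def)

lemma sum_list_remove_column:
  "is_partition xs \<Longrightarrow> sum_list (remove_column xs) + length xs = sum_list xs"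
  by (induction xs) (auto simp: is_partition_Cons remove_column_Cons, simp add: remove_column_def)

lemma is_partition_add_column: "is_partition xs \<Longrightarrow> is_partition (add_column a xs)"
proof -
  have "sorted_wrt (\<ge>) (replicate n (1 :: nat))" for n by (induction n) auto
  then show "is_partition xs \<Longrightarrow> ?thesis"
    by (auto simp: is_partition_def add_column_def sorted_wrt_append sorted_wrt_map)
qed

lemma length_add_column: "length xs \<le> a \<Longrightarrow> length (add_column a xs) = a"
  by (simp add: add_column_def)

lemma part_add_column:
  assumes "length xs \<le> a" "1 \<le> j"
  shows "part (add_column a xs) j = part xs j + (if j \<le> a then 1 else 0)"
  using assms by (auto simp: part_def add_column_def nth_append)

lemma sum_list_add_column: "length xs \<le> a \<Longrightarrow> sum_list (add_column a xs) = sum_list xs + a"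
proof -
  have "sum_list (map Suc xs) = sum_list xs + length xs" by (induction xs) auto
  then show "length xs \<le> a \<Longrightarrow> ?thesis" by (simp add: add_column_def sum_list_replicate)
qed

lemma remove_add_column: "is_partition xs \<Longrightarrow> remove_column (add_column a xs) = xs"
  by (auto simp: remove_column_def add_column_def is_partition_def o_def filter_id_conv)

text \<open>The parts equal to 1 are lost in the removal; the original length tells how many to
  restore.\<close>

lemma add_remove_column: "is_partition xs \<Longrightarrow> add_column (length xs) (remove_column xs) = xs"
proof (induction xs)
  case (Cons x xs)
  show ?case
  proof (cases "1 < x")
    case True
    then show ?thesis using Cons by (simp add: is_partition_Cons remove_column_Cons add_column_def)
  next
    case False
    then have "\<forall>y\<in>set (x # xs). y = 1" using Cons.prems
      by (fastforce simp: is_partition_Cons is_partition_def)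
    moreover from this have "x # xs = replicate (length (x # xs)) 1"
      by (metis replicate_eqI)
    ultimately show ?thesis using remove_column_eq_Nil[of "x # xs"] by (simp add: add_column_def)
  qed
qed (simp add: add_column_def remove_column_def)

section \<open>Cylindric partitions with separate bounds on the two lengths\<close>

definition cyl_le :: "nat \<Rightarrow> nat \<Rightarrow> nat \<Rightarrow> (nat list \<times> nat list) set" where
  "cyl_le a b k = {(l1, l2) \<in> cylindric_partitions 4 0.
     length l1 \<le> a \<and> length l2 \<le> b \<and> sum_list l1 + sum_list l2 = k}"

definition cyl_eq :: "nat \<Rightarrow> nat \<Rightarrow> nat \<Rightarrow> (nat list \<times> nat list) set" where
  "cyl_eq a b k = {(l1, l2) \<in> cylindric_partitions 4 0.
     length l1 = a \<and> length l2 = b \<and> sum_list l1 + sum_list l2 = k}"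

text \<open>The series F(a,b) of the overview.\<close>

definition cyl_gf :: "nat \<Rightarrow> nat \<Rightarrow> rat fps" where
  "cyl_gf a b = Abs_fps (\<lambda>k. of_nat (card (cyl_le a b k)))"

lemma CP_eq_cyl_gf: "CP 4 0 n = cyl_gf n n"
  by (simp add: CP_def cyl_gf_def cyl_le_def bounded_cylindric_partitions_def)

lemma finite_cyl_le: "finite (cyl_le a b k)"
  by (rule finite_subset[OF _ finite_bounded_cylindric_partitions[of 4 0 "max a b" k]])
     (auto simp: cyl_le_def bounded_cylindric_partitions_def)

lemma finite_cyl_eq: "finite (cyl_eq a b k)"
  by (rule finite_subset[OF _ finite_cyl_le[of a b k]]) (auto simp: cyl_le_def cyl_eq_def)

text \<open>The last positive part of \<open>l2\<close> forces a positive part of \<open>l1\<close>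
  at the same index. The first zero part of \<open>l2\<close>, at index
  \<open>length l2 + 1\<close>, forces a zero of \<open>l1\<close> four places later.\<close>

lemma cylindric_partition_lengths:
  assumes "(l1, l2) \<in> cylindric_partitions 4 0"
  shows "length l2 \<le> length l1" "length l1 \<le> length l2 + 4"
proof -
  have p: "is_partition l1" "is_partition l2"
    and c: "\<And>j. 1 \<le> j \<Longrightarrow> part l2 j \<le> part l1 j \<and> part l1 (j + 4) \<le> part l2 j"
    using assms by (auto simp: cylindric_partitions_def)
  show "length l2 \<le> length l1"
    using part_pos_iff[OF p(2), of "length l2"] part_pos_iff[OF p(1), of "length l2"]
      c[of "length l2"] by (cases "length l2") auto
  show "length l1 \<le> length l2 + 4"
    using part_pos_iff[OF p(2), of "length l2 + 1"] part_pos_iff[OF p(1), of "length l2 + 1 + 4"]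
      c[of "length l2 + 1"] by auto
qed

lemma cyl_gf_lower_boundary: "cyl_gf a (Suc a) = cyl_gf a a"
proof -
  have "cyl_le a (Suc a) k = cyl_le a a k" for k
    using cylindric_partition_lengths(1) by (fastforce simp: cyl_le_def)
  then show ?thesis by (simp add: cyl_gf_def)
qed

lemma cyl_gf_upper_boundary: "cyl_gf (b + 5) b = cyl_gf (b + 4) b"
proof -
  have "cyl_le (b + 5) b k = cyl_le (b + 4) b k" for k
    using cylindric_partition_lengths(2) by (fastforce simp: cyl_le_def)
  then show ?thesis by (simp add: cyl_gf_def)
qed

text \<open>Truncated decrement is monotone, so removal preserves the cylindric inequalities. Adding
  columns of heights a and b preserves them because j \<le> b implies j \<le> a, and j + 4 \<le> a
  implies j \<le> b; these are the two strip conditions.\<close>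

lemma bij_betw_remove_column:
  assumes "b \<le> a" "a \<le> b + 4"
  shows "bij_betw (map_prod remove_column remove_column) (cyl_eq a b (k + (a + b))) (cyl_le a b k)"
proof (rule bij_betw_byWitness[where f' = "map_prod (add_column a) (add_column b)"])
  show "\<forall>l\<in>cyl_eq a b (k + (a + b)).
      map_prod (add_column a) (add_column b) (map_prod remove_column remove_column l) = l"
    using add_remove_column by (auto simp: cyl_eq_def cylindric_partitions_def)
  show "\<forall>l\<in>cyl_le a b k.
      map_prod remove_column remove_column (map_prod (add_column a) (add_column b) l) = l"
    by (auto simp: cyl_le_def cylindric_partitions_def remove_add_column)
  show "map_prod remove_column remove_column ` cyl_eq a b (k + (a + b)) \<subseteq> cyl_le a b k"
  proof (rule image_subsetI, clarify)
    fix l1 l2 assume "(l1, l2) \<in> cyl_eq a b (k + (a + b))"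
    then show "map_prod remove_column remove_column (l1, l2) \<in> cyl_le a b k"
      using sum_list_remove_column[of l1] sum_list_remove_column[of l2]
        length_remove_column[of l1] length_remove_column[of l2]
      by (auto simp: cyl_eq_def cyl_le_def cylindric_partitions_def is_partition_remove_column
          part_remove_column diff_le_mono)
  qed
  show "map_prod (add_column a) (add_column b) ` cyl_le a b k \<subseteq> cyl_eq a b (k + (a + b))"
  proof (rule image_subsetI, clarify)
    fix l1 l2 assume l: "(l1, l2) \<in> cyl_le a b k"
    have "part (add_column b l2) j \<le> part (add_column a l1) j \<and>
        part (add_column a l1) (j + 4) \<le> part (add_column b l2) j" if j: "1 \<le> j" for j
    proof -
      have "part l2 j \<le> part l1 j" "part l1 (j + 4) \<le> part l2 j" "length l1 \<le> a" "length l2 \<le> b"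
        using l j by (auto simp: cyl_le_def cylindric_partitions_def)
      then show ?thesis using assms j by (simp add: part_add_column)
    qed
    then show "map_prod (add_column a) (add_column b) (l1, l2) \<in> cyl_eq a b (k + (a + b))"
      using l by (auto simp: cyl_eq_def cyl_le_def cylindric_partitions_def is_partition_add_column
          sum_list_add_column length_add_column)
  qed
qed

lemma cyl_eq_empty: "k < a + b \<Longrightarrow> cyl_eq a b k = {}"
proof -
  have "length xs \<le> sum_list xs" if "is_partition xs" for xs
    using sum_list_remove_column[OF that] by simp
  then have "a + b \<le> k" if "(l1, l2) \<in> cyl_eq a b k" for l1 l2
    using that by (auto simp: cyl_eq_def cylindric_partitions_def intro: add_mono)
  then show "k < a + b \<Longrightarrow> ?thesis"
    by (metis not_less equals0I surj_pair)
qed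

text \<open>The two removed columns have a + b cells in total, hence the factor q^(a+b).\<close>

lemma card_cyl_eq:
  assumes "b \<le> a" "a \<le> b + 4"
  shows "of_nat (card (cyl_eq a b k)) = fps_nth (fps_X ^ (a + b) * cyl_gf a b) k"
proof (cases "k < a + b")
  case True
  then show ?thesis by (simp add: cyl_eq_empty fps_X_power_mult_nth)
next
  case False
  then show ?thesis
    using bij_betw_same_card[OF bij_betw_remove_column[OF assms, of "k - (a + b)"]]
    by (simp add: fps_X_power_mult_nth cyl_gf_def)
qed

lemma cyl_gf_rec:
  assumes "b \<le> a" "a \<le> b + 4"
  shows "cyl_gf (Suc a) (Suc b) + cyl_gf a b
    = cyl_gf a (Suc b) + cyl_gf (Suc a) b + fps_X ^ (Suc a + Suc b) * cyl_gf (Suc a) (Suc b)"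
proof (rule fps_ext)
  fix k
  let ?A = "cyl_le a (Suc b) k" and ?B = "cyl_le (Suc a) b k" and ?E = "cyl_eq (Suc a) (Suc b) k"
  \<comment> \<open>Either some length stays below its bound, or both bounds are attained.\<close>
  have "cyl_le (Suc a) (Suc b) k = (?A \<union> ?B) \<union> ?E" "(?A \<union> ?B) \<inter> ?E = {}" "?A \<inter> ?B = cyl_le a b k"
    by (auto simp: cyl_le_def cyl_eq_def)
  then have "card (cyl_le (Suc a) (Suc b) k) + card (cyl_le a b k) = card ?A + card ?B + card ?E"
    using card_Un_disjoint[of "?A \<union> ?B" ?E] card_Un_Int[of ?A ?B]
    by (simp add: finite_cyl_le finite_cyl_eq)
  then have "(of_nat (card (cyl_le (Suc a) (Suc b) k)) + of_nat (card (cyl_le a b k)) :: rat)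
      = of_nat (card ?A) + of_nat (card ?B) + of_nat (card ?E)"
    by (simp flip: of_nat_add)
  moreover have "of_nat (card ?E)
      = fps_nth (fps_X ^ (Suc a + Suc b) * cyl_gf (Suc a) (Suc b)) k"
    by (rule card_cyl_eq) (use assms in auto)
  ultimately show "fps_nth (cyl_gf (Suc a) (Suc b) + cyl_gf a b) k = fps_nth (cyl_gf a (Suc b)
      + cyl_gf (Suc a) b + fps_X ^ (Suc a + Suc b) * cyl_gf (Suc a) (Suc b)) k"
    by (simp add: cyl_gf_def)
qed

text \<open>On the edge b = 0 the second length is always 0, so only the first bound can be missed;
  a < 4 keeps (a + 1, 0) in the strip.\<close>

lemma cyl_gf_rec_0:
  assumes "a < 4"
  shows "cyl_gf (Suc a) 0 = cyl_gf a 0 + fps_X ^ Suc a * cyl_gf (Suc a) 0"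
proof (rule fps_ext)
  fix k
  have "cyl_le (Suc a) 0 k = cyl_le a 0 k \<union> cyl_eq (Suc a) 0 k" "cyl_le a 0 k \<inter> cyl_eq (Suc a) 0 k = {}"
    by (auto simp: cyl_le_def cyl_eq_def)
  then have "card (cyl_le (Suc a) 0 k) = card (cyl_le a 0 k) + card (cyl_eq (Suc a) 0 k)"
    by (simp add: card_Un_disjoint finite_cyl_le finite_cyl_eq)
  moreover have "of_nat (card (cyl_eq (Suc a) 0 k))
      = fps_nth (fps_X ^ (Suc a + 0) * cyl_gf (Suc a) 0) k"
    by (rule card_cyl_eq) (use assms in auto)
  ultimately show "fps_nth (cyl_gf (Suc a) 0) k
      = fps_nth (cyl_gf a 0 + fps_X ^ Suc a * cyl_gf (Suc a) 0) k"
    by (simp add: cyl_gf_def)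
qed

section \<open>Comparison of the two sides by induction\<close>

text \<open>The strip is widened by one on each side, since the recurrence on the lines a = b and a
  = b + 4 refers to points just outside it. The cases are the origin, the two added lines, the edge
  b = 0 and the remaining points.\<close>

lemma qpochhammer_mult_cyl_gf:
  assumes "b \<le> Suc a" "a \<le> b + 5"
  shows "qpochhammer fps_X fps_X (a + b) * cyl_gf a b = altsum (int a) (int b)"
  using assms
proof (induction "a + b" arbitrary: a b rule: less_induct)
  case less
  let ?p = "\<lambda>n. qpochhammer fps_X fps_X n :: rat fps"
  consider "a = 0" "b = 0" | "b = Suc a" | "a = b + 5" | a' where "b = 0" "a = Suc a'" "a' < 4"
    | a' b' where "a = Suc a'" "b = Suc b'" "b' \<le> a'" "a' \<le> b' + 4"
    using less.prems by (cases a; cases b) force+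
  then show ?case
  proof cases
    case 1
    then show ?thesis by (simp add: altsum_0_0 flip: CP_eq_cyl_gf, simp add: CP_0 qpochhammer_def)
  next
    case 2
    \<comment> \<open>F does not change across the boundary, so only the new factor of the
      q-Pochhammer symbol appears, as in \<open>altsum_lower_boundary\<close>.\<close>
    have "?p (a + b) * cyl_gf a b = (1 - fps_X ^ (2 * a + 1)) * (?p (a + a) * cyl_gf a a)"
      by (simp add: 2 cyl_gf_lower_boundary qpochhammer_Suc mult_2)
    also have "?p (a + a) * cyl_gf a a = altsum (int a) (int a)"
      by (rule less.hyps) (use 2 in auto)
    finally show ?thesis
      using altsum_lower_boundary[of "int b"] by (simp add: 2 nat_add_distrib nat_mult_distrib)
  next
    case 3
    have "?p (a + b) = ?p (b + 4 + b) * (1 - fps_X ^ (2 * b + 5))"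
      using qpochhammer_Suc[of "b + 4 + b"] by (simp add: 3 mult_2 algebra_simps)
    then have "?p (a + b) * cyl_gf a b
        = (1 - fps_X ^ (2 * b + 5)) * (?p (b + 4 + b) * cyl_gf (b + 4) b)"
      by (simp add: 3 cyl_gf_upper_boundary)
    also have "?p (b + 4 + b) * cyl_gf (b + 4) b = altsum (int (b + 4)) (int b)"
      by (rule less.hyps) (use 3 in auto)
    finally show ?thesis
      using altsum_upper_boundary[of "int b"] by (simp add: 3 nat_add_distrib nat_mult_distrib)
  next
    case 4
    have "?p (a + b) * cyl_gf a b = ?p a' * ((1 - fps_X ^ Suc a') * cyl_gf (Suc a') 0)"
      by (simp add: 4 qpochhammer_Suc)
    also have "(1 - fps_X ^ Suc a') * cyl_gf (Suc a') 0 = cyl_gf a' 0"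
      using cyl_gf_rec_0[OF 4(3)] by (simp add: algebra_simps)
    also have "?p a' * cyl_gf a' 0 = altsum (int a') 0"
      using less.hyps[of a' 0] 4 by simp
    \<comment> \<open>At b = 0 the two terms of \<open>altsum_rec\<close> with second argument -1
      vanish.\<close>
    also have "\<dots> = altsum (int a) (int b)"
      using altsum_rec[of "int a" "int b"] 4
      by (simp add: altsum_minus_1)
    finally show ?thesis .
  next
    case 5
    let ?N = "a' + b'"
    have IH: "?p (Suc ?N) * cyl_gf a' (Suc b') = altsum (int a') (int b)"
      "?p (Suc ?N) * cyl_gf (Suc a') b' = altsum (int a) (int b')"
      "?p ?N * cyl_gf a' b' = altsum (int a') (int b')"
      using less.hyps[of a' b] less.hyps[of a b'] less.hyps[of a' b'] 5 by auto
    have "?p (a + b) * cyl_gf a b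
        = ?p (Suc ?N) * ((1 - fps_X ^ (Suc a' + Suc b')) * cyl_gf (Suc a') (Suc b'))"
      by (simp add: 5 qpochhammer_Suc)
    also have "(1 - fps_X ^ (Suc a' + Suc b')) * cyl_gf (Suc a') (Suc b')
        = cyl_gf a' (Suc b') + cyl_gf (Suc a') b' - cyl_gf a' b'"
      using cyl_gf_rec[OF 5(3,4)] by (simp add: algebra_simps)
    \<comment> \<open>F(a',b') needs only (q;q)_N; the surplus factor 1 - q^(N+1) is the coefficient
      1 - q^(a+b-1) of \<open>altsum_rec\<close>.\<close>
    also have "?p (Suc ?N) * \<dots> = ?p (Suc ?N) * cyl_gf a' (Suc b')
        + ?p (Suc ?N) * cyl_gf (Suc a') b' - (1 - fps_X ^ Suc ?N) * (?p ?N * cyl_gf a' b')"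
      by (simp add: qpochhammer_Suc algebra_simps)
    also have "\<dots> = altsum (int a) (int b)"
      unfolding IH using altsum_rec[of "int a" "int b"] 5 by (simp add: nat_add_distrib)
    finally show ?thesis .
  qed
qed

theorem theorem5p2:
  fixes n :: nat
  shows "qpochhammer fps_X fps_X (2 * n) * CP 4 0 n =
    Sum_any (\<lambda>r :: int. (-1) ^ nat \<bar>r\<bar> * fps_X ^ nat (r * (3 * r + 2)) *
      qbinomial (2 * int n) (int n - 3 * r + (-1) ^ nat \<bar>r\<bar> - 1))"
  unfolding CP_eq_cyl_gf Sum_any_eq_altsum
  using qpochhammer_mult_cyl_gf[of n n] by (simp add: mult_2)

end
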